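(* For any linear congestion game with restricted altruistic social context $(\mathcal{G},\Gamma)$, normalized so that $\gamma_{ii}=1$ for all $i$ (with $\Gamma$ not necessarily symmetric), it holds $\mathsf{PoA}(\mathcal{G},\Gamma)\le\frac{17}{3}$.
   Context: Linear congestion game: a set of players $[n]=\{1,\dots,n\}$, $n\ge 2$, a finite set $E$ of resources, for each player $i$ a non-empty set $S_i\subseteq 2^E$ of strategies (each strategy is a non-empty subset of $E$), and for each $e\in E$ a latency function $\ell_e(x)=\alpha_e x+\beta_e$ with $\alpha_e,\beta_e\ge 0$. A strategy profile is $S=(s_1,\dots,s_n)$ with $s_i\in S_i$. The congestion of $e$ in $S$ is $n_e(S)=|\{j\in[n]:e\in s_j\}|$, and the cost of player $i$ in the underlying game is $c_i(S)=\sum_{e\in s_i}(\alpha_e n_e(S)+\beta_e)$. For $t\in S_i$, $S_{-i}\diamond t$ denotes the profile obtained from $S$ by replacing $s_i$ with $t$. A linear congestion game with altruistic social context is a pair $(\mathcal{G},\Gamma)$ where $\mathcal{G}$ is a linear congestion game with $n$ players and $\Gamma=(\gamma_{ij})\in\mathbb{R}^{n\times n}$ has non-negative entries; players and strategies are those of $\mathcal{G}$, but the cost of player $i$ in $S$ is $\widehat{c}_i(S)=\sum_{j\in[n]}\gamma_{ij}\,c_j(S)$. The social context is restricted if $\gamma_{ii}\ge\gamma_{ij}$ for all $i,j$; in this case it is normalized so that $\gamma_{ii}=1$ for every $i$, so that $\gamma_{ij}\in[0,1]$. A pure Nash equilibrium of $(\mathcal{G},\Gamma)$ is a profile $S$ with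 $\widehat{c}_i(S)\le\widehat{c}_i(S_{-i}\diamond t)$ for every player $i$ and every $t\in S_i$. The social function is $\mathsf{SUM}(S)=\sum_{i\in[n]}c_i(S)$ (sum of the costs in the underlying game), and $S^*$ is a profile minimizing it. The price of anarchy $\mathsf{PoA}(\mathcal{G},\Gamma)$ is the maximum of $\mathsf{SUM}(S)/\mathsf{SUM}(S^* )$ over pure Nash equilibria $S$ of $(\mathcal{G},\Gamma)$; the bound $\mathsf{PoA}\le\rho$ means $\mathsf{SUM}(S)\le\rho\,\mathsf{SUM}(S^* )$ for every pure Nash equilibrium $S$ (vacuous if there are none). *)

theory Defs
  imports "HOL-Analysis.Analysis"
begin

record 'e congestion_game =
  num_players :: nat
  resources :: "'e set"
  strategies :: "nat \<Rightarrow> 'e set set"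
  slope :: "'e \<Rightarrow> real"
  offset :: "'e \<Rightarrow> real"

definition players :: "'e congestion_game \<Rightarrow> nat set" where
  "players G = {1..num_players G}"

definition linear_congestion_game :: "'e congestion_game \<Rightarrow> bool" where
  "linear_congestion_game G \<longleftrightarrow>
     num_players G \<ge> 2 \<and>
     finite (resources G) \<and>
     (\<forall>i\<in>players G. strategies G i \<noteq> {} \<and> strategies G i \<subseteq> Pow (resources G) - {{}}) \<and>
     (\<forall>e\<in>resources G. slope G e \<ge> 0 \<and> offset G e \<ge> 0)"

definition latency :: "'e congestion_game \<Rightarrow> 'e \<Rightarrow> real \<Rightarrow> real" where
  "latency G e x = slope G e * x + offset G e"

(* Extensional functions, so that profiles correspond exactly to n-tuples;
   replacing the strategy of player i by t is the function update S(i := t). *)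
definition profiles :: "'e congestion_game \<Rightarrow> (nat \<Rightarrow> 'e set) set" where
  "profiles G = (\<Pi>\<^sub>E i\<in>players G. strategies G i)"

definition congestion :: "'e congestion_game \<Rightarrow> (nat \<Rightarrow> 'e set) \<Rightarrow> 'e \<Rightarrow> nat" where
  "congestion G S e = card {j \<in> players G. e \<in> S j}"

definition cost :: "'e congestion_game \<Rightarrow> (nat \<Rightarrow> 'e set) \<Rightarrow> nat \<Rightarrow> real" where
  "cost G S i = (\<Sum>e\<in>S i. latency G e (real (congestion G S e)))"

definition social_cost :: "'e congestion_game \<Rightarrow> (nat \<Rightarrow> 'e set) \<Rightarrow> real" where
  "social_cost G S = (\<Sum>i\<in>players G. cost G S i)"

definition social_optimum :: "'e congestion_game \<Rightarrow> (nat \<Rightarrow> 'e set) \<Rightarrow> bool" where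
  "social_optimum G S \<longleftrightarrow>
     S \<in> profiles G \<and> (\<forall>T\<in>profiles G. social_cost G S \<le> social_cost G T)"

definition altruistic_context ::
  "'e congestion_game \<Rightarrow> (nat \<Rightarrow> nat \<Rightarrow> real) \<Rightarrow> bool" where
  "altruistic_context G \<Gamma> \<longleftrightarrow> (\<forall>i\<in>players G. \<forall>j\<in>players G. \<Gamma> i j \<ge> 0)"

definition restricted_context ::
  "'e congestion_game \<Rightarrow> (nat \<Rightarrow> nat \<Rightarrow> real) \<Rightarrow> bool" where
  "restricted_context G \<Gamma> \<longleftrightarrow>
     altruistic_context G \<Gamma> \<and> (\<forall>i\<in>players G. \<forall>j\<in>players G. \<Gamma> i j \<le> \<Gamma> i i)"

definition normalized_context ::
  "'e congestion_game \<Rightarrow> (nat \<Rightarrow> nat \<Rightarrow> real) \<Rightarrow> bool" where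
  "normalized_context G \<Gamma> \<longleftrightarrow> (\<forall>i\<in>players G. \<Gamma> i i = 1)"

definition altruistic_cost ::
  "'e congestion_game \<Rightarrow> (nat \<Rightarrow> nat \<Rightarrow> real) \<Rightarrow> (nat \<Rightarrow> 'e set) \<Rightarrow> nat \<Rightarrow> real" where
  "altruistic_cost G \<Gamma> S i = (\<Sum>j\<in>players G. \<Gamma> i j * cost G S j)"

definition pure_nash ::
  "'e congestion_game \<Rightarrow> (nat \<Rightarrow> nat \<Rightarrow> real) \<Rightarrow> (nat \<Rightarrow> 'e set) \<Rightarrow> bool" where
  "pure_nash G \<Gamma> S \<longleftrightarrow>
     S \<in> profiles G \<and>
     (\<forall>i\<in>players G. \<forall>t\<in>strategies G i.
        altruistic_cost G \<Gamma> S i \<le> altruistic_cost G \<Gamma> (S(i := t)) i)"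

(* The price of anarchy is at most r.  Stated without division, so that it is
   meaningful when the optimal social cost is 0, and true when there is no
   pure Nash equilibrium. *)
definition PoA_le ::
  "'e congestion_game \<Rightarrow> (nat \<Rightarrow> nat \<Rightarrow> real) \<Rightarrow> real \<Rightarrow> bool" where
  "PoA_le G \<Gamma> r \<longleftrightarrow>
     (\<forall>S T. pure_nash G \<Gamma> S \<longrightarrow> social_optimum G T \<longrightarrow>
        social_cost G S \<le> r * social_cost G T)"

(* A social optimum always exists, so the quantification over T above is never vacuous. *)
lemma social_optimum_exists:
  assumes "linear_congestion_game G"
  shows "\<exists>T. social_optimum G T"
proof -
  have fin: "finite (profiles G)"
    unfolding profiles_def
  proof (rule finite_PiE)
    show "finite (players G)" by (simp add: players_def)
    fix i assume "i \<in> players G"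
    then have "strategies G i \<subseteq> Pow (resources G)" "finite (resources G)"
      using assms by (auto simp: linear_congestion_game_def)
    then show "finite (strategies G i)"
      by (meson finite_Pow_iff finite_subset)
  qed
  have ne: "profiles G \<noteq> {}"
    using assms by (auto simp: profiles_def PiE_eq_empty_iff linear_congestion_game_def)
  obtain T where "is_arg_min (social_cost G) (\<lambda>S. S \<in> profiles G) T"
    using ex_is_arg_min_if_finite[OF fin ne] by blast
  then show ?thesis
    by (auto simp: social_optimum_def is_arg_min_linorder)
qed

end

theory Submission
  imports Defs
begin

text \<open>At an equilibrium, the restriction \<open>\<Gamma> i j \<le> 1\<close> bounds the change in the altruistic cost when
  a player joins a resource of congestion \<open>x\<close> by \<open>\<alpha> * (2 * x + 1) + \<beta>\<close>, while leaving a resource saves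
  the player at least its latency. Summing the equilibrium conditions for the deviations to the
  optimum gives \<open>SUM S \<le> (\<Sum>e. y * (\<alpha> * (2 * x + 1) + \<beta>))\<close>, where \<open>y\<close> is the congestion in
  the optimum. The integer inequality \<open>y * (2 * x + 1) \<le> 17 / 5 * y\<^sup>2 + 2 / 5 * x\<^sup>2\<close>, tight at
  \<open>y = 1\<close> and \<open>x \<in> {2, 3}\<close>, then yields the ratio \<open>(17 / 5) / (1 - 2 / 5) = 17 / 3\<close>.\<close>

lemma finite_players [simp]: "finite (players G)"
  by (simp add: players_def)

text \<open>Double counting of pairs of a player and a resource in its strategy. As \<open>f\<close>
  is arbitrary, this serves both the social cost and the summed deviation bounds.\<close>

lemma sum_players_resources:
  fixes f :: "'e \<Rightarrow> real"
  assumes "finite (resources G)" and "\<And>i. i \<in> players G \<Longrightarrow> S i \<subseteq> resources G"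
  shows "(\<Sum>i\<in>players G. \<Sum>e\<in>S i. f e) = (\<Sum>e\<in>resources G. real (congestion G S e) * f e)"
proof -
  have "(\<Sum>i\<in>players G. \<Sum>e\<in>S i. f e)
      = (\<Sum>i\<in>players G. \<Sum>e\<in>{e \<in> resources G. e \<in> S i}. f e)"
    using assms(2) by (intro sum.cong) auto
  also have "\<dots> = (\<Sum>e\<in>resources G. \<Sum>i\<in>{i \<in> players G. e \<in> S i}. f e)"
    using assms(1) by (intro sum.swap_restrict) auto
  finally show ?thesis
    by (simp add: congestion_def)
qed

lemma profile_subset_resources:
  assumes "linear_congestion_game G" "S \<in> profiles G" "i \<in> players G"
  shows "S i \<subseteq> resources G"
  using assms by (fastforce simp: linear_congestion_game_def profiles_def PiE_iff)

lemma altruistic_cost_resources: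
  assumes "finite (resources G)" and "\<And>j. j \<in> players G \<Longrightarrow> S j \<subseteq> resources G"
  shows "altruistic_cost G \<Gamma> S i = (\<Sum>e\<in>resources G.
    latency G e (real (congestion G S e)) * (\<Sum>j\<in>{j \<in> players G. e \<in> S j}. \<Gamma> i j))"
proof -
  have "altruistic_cost G \<Gamma> S i = (\<Sum>j\<in>players G. \<Sum>e\<in>{e \<in> resources G. e \<in> S j}.
      latency G e (real (congestion G S e)) * \<Gamma> i j)"
    unfolding altruistic_cost_def cost_def sum_distrib_left
    using assms(2) by (intro sum.cong) auto
  also have "\<dots> = (\<Sum>e\<in>resources G. \<Sum>j\<in>{j \<in> players G. e \<in> S j}.
      latency G e (real (congestion G S e)) * \<Gamma> i j)"
    using assms(1) by (intro sum.swap_restrict) auto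
  finally show ?thesis
    by (simp add: sum_distrib_left)
qed

text \<open>Leaving out \<open>i\<close> makes the set invariant under deviations of
  \<open>i\<close>, so both sides of an equilibrium condition can be written in the same
  quantities.\<close>

definition other_users :: "'e congestion_game \<Rightarrow> (nat \<Rightarrow> 'e set) \<Rightarrow> nat \<Rightarrow> 'e \<Rightarrow> nat set" where
  "other_users G S i e = {j \<in> players G - {i}. e \<in> S j}"

lemma finite_other_users [simp]: "finite (other_users G S i e)"
  by (simp add: other_users_def)

lemma other_users_upd [simp]: "other_users G (S(i := t)) i e = other_users G S i e"
  by (auto simp: other_users_def)

lemma users_eq:
  assumes "i \<in> players G"
  shows "{j \<in> players G. e \<in> S j} =
    (if e \<in> S i then insert i (other_users G S i e) else other_users G S i e)"
  using assms by (auto simp: other_users_def)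

lemma congestion_other_users:
  assumes "i \<in> players G"
  shows "congestion G S e = card (other_users G S i e) + (if e \<in> S i then 1 else 0)"
  unfolding congestion_def users_eq[OF assms] by (simp add: other_users_def)

text \<open>Separates the part of the altruistic cost that does not depend on the strategy of player \<open>i\<close>,
  so that it cancels when two strategies are compared.\<close>

lemma altruistic_cost_split:
  assumes "finite (resources G)" and sub: "\<And>j. j \<in> players G \<Longrightarrow> S j \<subseteq> resources G"
    and i: "i \<in> players G" and "\<Gamma> i i = 1"
  shows "altruistic_cost G \<Gamma> S i =
    (\<Sum>e\<in>resources G. latency G e (real (card (other_users G S i e))) *
        (\<Sum>j\<in>other_users G S i e. \<Gamma> i j))
    + (\<Sum>e\<in>S i. latency G e (real (card (other_users G S i e)) + 1)
        + slope G e * (\<Sum>j\<in>other_users G S i e. \<Gamma> i j))"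
    (is "_ = (\<Sum>e\<in>_. ?A e) + (\<Sum>e\<in>_. ?B e)")
proof -
  \<comment> \<open>The weight of \<open>i\<close> itself is 1, so with \<open>m\<close> other users
    of total weight \<open>W\<close>, its presence on \<open>e\<close> adds its own latency at
    \<open>m + 1\<close> plus the extra delay \<open>slope G e * W\<close> felt through the
    others.\<close>
  have "latency G e (real (congestion G S e)) * (\<Sum>j\<in>{j \<in> players G. e \<in> S j}. \<Gamma> i j)
      = ?A e + (if e \<in> S i then ?B e else 0)" for e
  proof -
    have "i \<notin> other_users G S i e"
      by (simp add: other_users_def)
    then show ?thesis
      unfolding users_eq[OF i] congestion_other_users[OF i]
      using assms(4) by (simp add: latency_def algebra_simps)
  qed
  then have "altruistic_cost G \<Gamma> S i =
      (\<Sum>e\<in>resources G. ?A e) + (\<Sum>e\<in>resources G. if e \<in> S i then ?B e else 0)"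
    by (simp add: altruistic_cost_resources[OF assms(1) sub] sum.distrib)
  also have "(\<Sum>e\<in>resources G. if e \<in> S i then ?B e else 0) = (\<Sum>e\<in>S i. ?B e)"
    using sub[OF i] assms(1) by (simp add: sum.inter_restrict[symmetric] Int_absorb1)
  finally show ?thesis .
qed

text \<open>The move is viewed as \<open>i\<close> leaving all of \<open>S i\<close> and then
  entering \<open>t\<close>, so resources in both sets need no separate case.\<close>

lemma cost_le_deviation:
  assumes game: "linear_congestion_game G"
    and ctx: "restricted_context G \<Gamma>" "normalized_context G \<Gamma>"
    and nash: "pure_nash G \<Gamma> S"
    and i: "i \<in> players G" and t: "t \<in> strategies G i"
  shows "cost G S i \<le>
    (\<Sum>e\<in>t. slope G e * (2 * real (congestion G S e) + 1) + offset G e)"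
proof -
  have fin: "finite (resources G)"
    and coeff: "\<And>e. e \<in> resources G \<Longrightarrow> 0 \<le> slope G e"
    using game by (auto simp: linear_congestion_game_def)
  have sub: "S j \<subseteq> resources G" if "j \<in> players G" for j
    using nash that by (intro profile_subset_resources[OF game]) (auto simp: pure_nash_def)
  have t_sub: "t \<subseteq> resources G"
    using game i t by (auto simp: linear_congestion_game_def)
  have sub': "(S(i := t)) j \<subseteq> resources G" if "j \<in> players G" for j
    using sub[OF that] t_sub by simp
  have \<Gamma>ii: "\<Gamma> i i = 1"
    using ctx i by (simp add: normalized_context_def)
  have \<Gamma>: "0 \<le> \<Gamma> i j" "\<Gamma> i j \<le> 1" if "j \<in> players G" for j
    using ctx i that \<Gamma>ii
    by (force simp: restricted_context_def altruistic_context_def)+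
  define m where "m e = real (card (other_users G S i e))" for e
  define W where "W e = (\<Sum>j\<in>other_users G S i e. \<Gamma> i j)" for e
  have W_nonneg: "0 \<le> W e" for e
    unfolding W_def using \<Gamma> by (intro sum_nonneg) (auto simp: other_users_def)
  have W_le: "W e \<le> m e" for e
    unfolding W_def m_def using \<Gamma> sum_bounded_above[of "other_users G S i e" "\<Gamma> i" 1]
    by (auto simp: other_users_def)
  have m_le: "m e \<le> congestion G S e" for e
    by (simp add: m_def congestion_other_users[OF i])
  have "cost G S i \<le> (\<Sum>e\<in>S i. latency G e (m e + 1) + slope G e * W e)"
    unfolding cost_def
  proof (rule sum_mono)
    fix e assume "e \<in> S i"
    then show "latency G e (congestion G S e) \<le> latency G e (m e + 1) + slope G e * W e"
      using coeff[of e] sub[OF i] W_nonneg[of e]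
      by (auto simp: congestion_other_users[OF i] m_def add.commute)
  qed
  also have "\<dots> \<le> (\<Sum>e\<in>t. latency G e (m e + 1) + slope G e * W e)"
  proof -
    have "altruistic_cost G \<Gamma> S i \<le> altruistic_cost G \<Gamma> (S(i := t)) i"
      using nash i t by (simp add: pure_nash_def)
    then show ?thesis
      by (simp add: altruistic_cost_split[where S = S and \<Gamma> = \<Gamma>, OF fin sub i \<Gamma>ii]
          altruistic_cost_split[where S = "S(i := t)" and \<Gamma> = \<Gamma>, OF fin sub' i \<Gamma>ii]
          m_def W_def)
  qed
  also have "\<dots> \<le> (\<Sum>e\<in>t. slope G e * (2 * real (congestion G S e) + 1) + offset G e)"
  proof (rule sum_mono)
    fix e assume "e \<in> t"
    \<comment> \<open>One copy of the congestion bounds \<open>m e\<close>, the other bounds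
      \<open>W e\<close>, where \<Gamma> at most 1 is used.\<close>
    then have "slope G e * (m e + 1 + W e) \<le> slope G e * (2 * real (congestion G S e) + 1)"
      using coeff[of e] t_sub W_le[of e] m_le[of e] by (intro mult_left_mono) auto
    then show "latency G e (m e + 1) + slope G e * W e
        \<le> slope G e * (2 * real (congestion G S e) + 1) + offset G e"
      by (simp add: latency_def algebra_simps)
  qed
  finally show ?thesis .
qed

text \<open>Integrality is essential: the inequality fails at \<open>y = 1\<close>,
  \<open>x = 5 / 2\<close>. Equality at the two tight points determines both coefficients.\<close>

lemma nat_smoothness:
  fixes x y :: nat
  shows "real y * (2 * real x + 1) \<le> 17 / 5 * (real y)\<^sup>2 + 2 / 5 * (real x)\<^sup>2"
proof -
  consider "y = 0" | "y = 1" | "y \<ge> 2" by linarith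
  then show ?thesis
  proof cases
    case 2
    \<comment> \<open>For \<open>y = 1\<close> the slack is \<open>2 / 5\<close> times this product,
      which could be negative only strictly between 2 and 3.\<close>
    have "0 \<le> (real x - 2) * (real x - 3)"
      by (cases "x \<le> 2") (auto intro: mult_nonpos_nonpos)
    with 2 show ?thesis
      by (simp add: power2_eq_square algebra_simps)
  next
    case 3
    \<comment> \<open>Replacing the linear term \<open>y\<close> by \<open>y * y / 2\<close> leaves
      a slack of \<open>(2 * x - 5 * y)\<^sup>2 / 10 + 2 / 5 * y * y\<close>.\<close>
    then have "2 * real y \<le> real y * real y"
      by (intro mult_right_mono) auto
    moreover have "0 \<le> (2 * real x - 5 * real y)\<^sup>2" "0 \<le> real y * real y"
      by simp_all
    ultimately show ?thesis
      by (simp add: power2_eq_square algebra_simps)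
  qed simp
qed

theorem theorem4:
  fixes G :: "'e congestion_game" and \<Gamma> :: "nat \<Rightarrow> nat \<Rightarrow> real"
  assumes "linear_congestion_game G"
    and "restricted_context G \<Gamma>"
    and "normalized_context G \<Gamma>"
  shows "PoA_le G \<Gamma> (17 / 3)"
  unfolding PoA_le_def
proof (intro allI impI)
  fix S T
  assume nash: "pure_nash G \<Gamma> S" and opt: "social_optimum G T"
  have S: "S \<in> profiles G" and T: "T \<in> profiles G"
    using nash opt by (auto simp: pure_nash_def social_optimum_def)
  have fin: "finite (resources G)"
    and coeff: "\<And>e. e \<in> resources G \<Longrightarrow> 0 \<le> slope G e \<and> 0 \<le> offset G e"
    using assms(1) by (auto simp: linear_congestion_game_def)
  define x where "x e = real (congestion G S e)" for e
  define y where "y e = real (congestion G T e)" for e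
  have SUM_S: "social_cost G S = (\<Sum>e\<in>resources G. x e * latency G e (x e))"
    unfolding social_cost_def cost_def x_def
    by (intro sum_players_resources fin profile_subset_resources[OF assms(1) S])
  have SUM_T: "social_cost G T = (\<Sum>e\<in>resources G. y e * latency G e (y e))"
    unfolding social_cost_def cost_def y_def
    by (intro sum_players_resources fin profile_subset_resources[OF assms(1) T])
  have "social_cost G S \<le>
      (\<Sum>i\<in>players G. \<Sum>e\<in>T i. slope G e * (2 * x e + 1) + offset G e)"
    unfolding social_cost_def x_def
    using T by (intro sum_mono cost_le_deviation[OF assms nash]) (auto simp: profiles_def)
  also have "\<dots> = (\<Sum>e\<in>resources G. y e * (slope G e * (2 * x e + 1) + offset G e))"
    unfolding y_def
    by (intro sum_players_resources fin profile_subset_resources[OF assms(1) T])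
  also have "\<dots> \<le> (\<Sum>e\<in>resources G.
      17 / 5 * (y e * latency G e (y e)) + 2 / 5 * (x e * latency G e (x e)))"
  proof (rule sum_mono)
    fix e assume e: "e \<in> resources G"
    have "slope G e * (y e * (2 * x e + 1)) \<le> slope G e * (17 / 5 * (y e)\<^sup>2 + 2 / 5 * (x e)\<^sup>2)"
      using coeff[OF e] unfolding x_def y_def by (intro mult_left_mono nat_smoothness) auto
    \<comment> \<open>The offset terms need only these signs, since \<open>17 / 5\<close> exceeds
      1.\<close>
    moreover have "0 \<le> offset G e * x e" "0 \<le> offset G e * y e"
      using coeff[OF e] by (simp_all add: x_def y_def)
    ultimately show "y e * (slope G e * (2 * x e + 1) + offset G e)
        \<le> 17 / 5 * (y e * latency G e (y e)) + 2 / 5 * (x e * latency G e (x e))"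
      by (simp add: latency_def power2_eq_square algebra_simps)
  qed
  also have "\<dots> = 17 / 5 * social_cost G T + 2 / 5 * social_cost G S"
    by (simp add: SUM_S SUM_T sum.distrib sum_distrib_left)
  finally show "social_cost G S \<le> 17 / 3 * social_cost G T"
    by simp
qed

end
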